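(* Let $X$ be a separable Banach space, $p\ge1$, $\mu\in\mathcal P_p(X)$. Let $f\colon X\to\mathbb R$ be continuous and assume that there exist constants $M\ge0$ and $c\in[0,1)$ with $|f(x)|\le M+c\|x\|^p$ for all $x\in X$. Let $(D_n)_{n\in\mathbb N}$ be a family of subsets of $L^p(\mu;X)$ with $D_n\subset D_{n+1}$ for all $n\in\mathbb N$. If $D:=\bigcup_{n\in\mathbb N}D_n$ is dense in $L^p(\mu;X)$, then the risk measure $$\rho(f)=\sup_{\nu\in\mathcal P(X)}\bigg(\int_X f(y)\,\nu(\mathrm dy)-\mathcal W_p(\mu,\nu)^p\bigg)$$ can be approximated from below in the sense that $$\sup_{y\in D_n}\int_X\Big(f\big(x+y(x)\big)-\|y(x)\|^p\Big)\,\mu(\mathrm dx)\nearrow\rho(f)\quad\text{as }n\to\infty,$$ i.e. the left-hand side is nondecreasing in $n$ and converges to $\rho(f)$.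
   Context: $\mathcal P(X)$ is the set of Borel probability measures on $X$; $\mathcal P_p(X)$ is the subset of those $\nu$ with $\int_X\|x\|^p\,\nu(\mathrm dx)<\infty$. $\mathcal W_p(\mu,\nu):=\inf_{\pi}\big(\int_{X\times X}\|y-x\|^p\,\pi(\mathrm dx,\mathrm dy)\big)^{1/p}\in[0,\infty]$, the infimum being over all couplings $\pi$ of $\mu$ and $\nu$ (probability measures on $X\times X$ with marginals $\mu$ and $\nu$). $L^p(\mu;X)$ is the space of ($\mu$-equivalence classes of) Borel measurable functions $y\colon X\to X$ with $\int_X\|y(x)\|^p\,\mu(\mathrm dx)<\infty$, with its usual norm. Integrals are $\int g\,\mathrm d\nu:=\int g^+\,\mathrm d\nu-\int g^-\,\mathrm d\nu$ with the convention $\infty-\infty=-\infty$. *)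

theory Defs
  imports "HOL-Probability.Probability"
begin

text \<open>
  The library has no real power on \<open>ennreal\<close>. Only exponents \<open>a > 0\<close> are used, for which
  \<open>\<infinity>\<close> to the power \<open>a\<close> is \<open>\<infinity>\<close>.
\<close>

definition ennreal_powr :: "ennreal \<Rightarrow> real \<Rightarrow> ennreal" where
  "ennreal_powr t a = (if t = \<infinity> then \<infinity> else ennreal (enn2real t powr a))"

text \<open>
  Subtraction of extended reals with the convention \<open>\<infinity> - \<infinity> = -\<infinity>\<close>;
  on \<open>ereal\<close> the library has \<open>\<infinity> - \<infinity> = \<infinity>\<close> instead.
\<close>

definition ereal_minus_conv :: "ereal \<Rightarrow> ereal \<Rightarrow> ereal" where
  "ereal_minus_conv a b = (if a = \<infinity> \<and> b = \<infinity> then -\<infinity> else a - b)"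

text \<open>\<open>ennreal\<close> sends negative reals to \<open>0\<close>, so the two integrals are those of the positive and
  the negative part of \<open>g\<close>.\<close>

definition ext_integral :: "'a measure \<Rightarrow> ('a \<Rightarrow> real) \<Rightarrow> ereal" where
  "ext_integral \<nu> g =
     ereal_minus_conv (enn2ereal (\<integral>\<^sup>+ x. ennreal (g x) \<partial>\<nu>)) (enn2ereal (\<integral>\<^sup>+ x. ennreal (- g x) \<partial>\<nu>))"

definition borel_probs :: "'a::topological_space measure set" where
  "borel_probs = {\<nu>. sets \<nu> = sets borel \<and> prob_space \<nu>}"

definition borel_probs_p :: "real \<Rightarrow> 'a::real_normed_vector measure set" where
  "borel_probs_p p = {\<nu> \<in> borel_probs. (\<integral>\<^sup>+ x. ennreal (norm x powr p) \<partial>\<nu>) < \<infinity>}"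

definition couplings ::
  "'a::topological_space measure \<Rightarrow> 'a measure \<Rightarrow> ('a \<times> 'a) measure set" where
  "couplings \<mu> \<nu> = {\<pi> \<in> borel_probs. distr \<pi> borel fst = \<mu> \<and> distr \<pi> borel snd = \<nu>}"

definition wasserstein ::
  "real \<Rightarrow> 'a::real_normed_vector measure \<Rightarrow> 'a measure \<Rightarrow> ennreal" where
  "wasserstein p \<mu> \<nu> =
     (INF \<pi>\<in>couplings \<mu> \<nu>.
        ennreal_powr (\<integral>\<^sup>+ z. ennreal (norm (snd z - fst z) powr p) \<partial>\<pi>) (1 / p))"

definition Lp_funs :: "real \<Rightarrow> 'a::real_normed_vector measure \<Rightarrow> ('a \<Rightarrow> 'a) set" where
  "Lp_funs p \<mu> =
     {y \<in> borel_measurable borel. (\<integral>\<^sup>+ x. ennreal (norm (y x) powr p) \<partial>\<mu>) < \<infinity>}"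

definition Lp_rel :: "real \<Rightarrow> 'a::real_normed_vector measure \<Rightarrow> (('a \<Rightarrow> 'a) \<times> ('a \<Rightarrow> 'a)) set" where
  "Lp_rel p \<mu> = {(y, z). y \<in> Lp_funs p \<mu> \<and> z \<in> Lp_funs p \<mu> \<and> (AE x in \<mu>. y x = z x)}"

definition Lp_space :: "real \<Rightarrow> 'a::real_normed_vector measure \<Rightarrow> ('a \<Rightarrow> 'a) set set" where
  "Lp_space p \<mu> = Lp_funs p \<mu> // Lp_rel p \<mu>"

definition Lp_norm :: "real \<Rightarrow> 'a::real_normed_vector measure \<Rightarrow> ('a \<Rightarrow> 'a) \<Rightarrow> real" where
  "Lp_norm p \<mu> y = (\<integral>x. norm (y x) powr p \<partial>\<mu>) powr (1 / p)"

text \<open>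
  Elements of \<open>Lp_space\<close> are nonempty sets of representatives, and the norm of the difference
  does not depend on which representatives are taken.
\<close>

definition Lp_dense ::
  "real \<Rightarrow> 'a::real_normed_vector measure \<Rightarrow> ('a \<Rightarrow> 'a) set set \<Rightarrow> bool" where
  "Lp_dense p \<mu> D \<longleftrightarrow>
     D \<subseteq> Lp_space p \<mu> \<and>
     (\<forall>Y\<in>Lp_space p \<mu>. \<forall>\<epsilon>>0. \<exists>Z\<in>D. \<forall>y\<in>Y. \<forall>z\<in>Z. Lp_norm p \<mu> (\<lambda>x. y x - z x) < \<epsilon>)"

text \<open>
  The difference uses the convention \<open>\<infinity> - \<infinity> = -\<infinity>\<close> as well: a measure \<open>\<nu>\<close> at infinite distance
  from \<open>\<mu>\<close> never contributes to the supremum, even if \<open>f\<close> has \<open>\<nu>\<close>-integral \<open>\<infinity>\<close>.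
\<close>

definition risk_measure ::
  "real \<Rightarrow> 'a::real_normed_vector measure \<Rightarrow> ('a \<Rightarrow> real) \<Rightarrow> ereal" where
  "risk_measure p \<mu> f =
     (SUP \<nu>\<in>borel_probs.
        ereal_minus_conv (ext_integral \<nu> f) (enn2ereal (ennreal_powr (wasserstein p \<mu> \<nu>) p)))"

text \<open>
  The variable \<open>y\<close> ranges over all representatives of the classes in \<open>E\<close>; the integral depends
  only on the class of \<open>y\<close>. For empty \<open>E\<close> the value is \<open>-\<infinity>\<close>.
\<close>

definition transport_sup ::
  "real \<Rightarrow> 'a::real_normed_vector measure \<Rightarrow> ('a \<Rightarrow> real) \<Rightarrow> ('a \<Rightarrow> 'a) set set \<Rightarrow> ereal" where
  "transport_sup p \<mu> f E =
     (SUP y\<in>\<Union>E. ext_integral \<mu> (\<lambda>x. f (x + y x) - norm (y x) powr p))"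

end

theory Submission
  imports Defs
begin

text \<open>
  Write \<open>h x z = f z - \<parallel>z - x\<parallel>\<^sup>p\<close>. Integrating over a coupling with finite cost shows that
  \<open>\<rho>(f) \<le> \<integral> sup\<^sub>z h x z d\<mu>\<close>. By continuity of \<open>f\<close>, the inner supremum may be taken over
  \<open>x\<close> and a dense sequence; the best of \<open>x\<close> and the first \<open>m\<close> points of the sequence is a measurable
  transport map at finite \<open>L\<^sup>p\<close>-distance from the identity, and monotone convergence in \<open>m\<close> shows that
  \<open>\<rho>(f)\<close> is the supremum of \<open>\<integral> f (x + y x) - \<parallel>y x\<parallel>\<^sup>p d\<mu>\<close> over \<open>y \<in> L\<^sup>p\<close> (the converse bound uses
  the push-forward of \<open>\<mu>\<close> under \<open>x + y x\<close>). This functional is continuous on \<open>L\<^sup>p\<close>, so a dense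
  set gives the same supremum.
\<close>

section \<open>Growth estimates and integrability of p-th powers\<close>

text \<open>The norm of a sum is at most twice the larger norm. The crude constant
  \<open>2 powr p\<close> avoids convexity and is enough for integrable majorants.\<close>

lemma norm_add_powr_le:
  fixes a b :: "'a::real_normed_vector" and p :: real
  assumes "p \<ge> 0"
  shows "norm (a + b) powr p \<le> 2 powr p * (norm a powr p + norm b powr p)"
proof -
  have "norm (a + b) \<le> 2 * max (norm a) (norm b)"
    using norm_triangle_ineq[of a b] by linarith
  then have "norm (a + b) powr p \<le> (2 * max (norm a) (norm b)) powr p"
    using assms by (intro powr_mono2) auto
  also have "\<dots> = 2 powr p * max (norm a) (norm b) powr p"
    by (simp add: powr_mult)
  also have "\<dots> \<le> 2 powr p * (norm a powr p + norm b powr p)"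
    by (intro mult_left_mono) (auto simp: max_def)
  finally show ?thesis .
qed

lemma tendsto_norm_powr:
  fixes z :: "'b \<Rightarrow> 'a::real_normed_vector"
  assumes "(z \<longlongrightarrow> l) F" "p > 0"
  shows "((\<lambda>k. norm (z k) powr p) \<longlongrightarrow> norm l powr p) F"
  using assms by (intro tendsto_powr' tendsto_norm tendsto_const) auto

lemma integrable_norm_add_powr:
  fixes S T :: "'b \<Rightarrow> 'a::{real_normed_vector, second_countable_topology}"
  assumes "p \<ge> 0"
    and [measurable]: "S \<in> borel_measurable N" "T \<in> borel_measurable N"
    and "integrable N (\<lambda>x. norm (S x) powr p)" "integrable N (\<lambda>x. norm (T x) powr p)"
  shows "integrable N (\<lambda>x. norm (S x + T x) powr p)"
proof (rule Bochner_Integration.integrable_bound)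
  show "integrable N (\<lambda>x. 2 powr p * (norm (S x) powr p + norm (T x) powr p))"
    using assms by auto
qed (use norm_add_powr_le[OF assms(1)] in auto)

lemma integrable_norm_diff_powr:
  fixes S T :: "'b \<Rightarrow> 'a::{real_normed_vector, second_countable_topology}"
  assumes "p \<ge> 0"
    and [measurable]: "S \<in> borel_measurable N" "T \<in> borel_measurable N"
    and "integrable N (\<lambda>x. norm (S x) powr p)" "integrable N (\<lambda>x. norm (T x) powr p)"
  shows "integrable N (\<lambda>x. norm (S x - T x) powr p)"
  using integrable_norm_add_powr[of p S N "\<lambda>x. - T x"] assms by simp

text \<open>Stated for a general finite measure because it serves both for \<open>\<mu>\<close> and
  for couplings on the product space.\<close>

lemma integrable_comp_growth:
  fixes f :: "'a::{real_normed_vector, second_countable_topology} \<Rightarrow> real"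
  assumes "finite_measure N"
    and [measurable]: "f \<in> borel_measurable borel" "T \<in> borel_measurable N"
    and growth: "\<And>x. \<bar>f x\<bar> \<le> M + c * norm x powr p"
    and "integrable N (\<lambda>x. norm (T x) powr p)"
  shows "integrable N (\<lambda>x. f (T x))"
proof (rule Bochner_Integration.integrable_bound)
  interpret finite_measure N by fact
  show "integrable N (\<lambda>x. M + c * norm (T x) powr p)"
    using assms by auto
qed (use growth in \<open>auto intro!: order_trans[OF growth]\<close>)

section \<open>Extended integrals and representatives of L^p classes\<close>

text \<open>Both parts of an integrable function have finite integral, so the convention for the
  difference of infinities never applies.\<close>

lemma ext_integral_eq_integral:
  assumes "integrable \<nu> g"
  shows "ext_integral \<nu> g = ereal (\<integral>x. g x \<partial>\<nu>)"
proof -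
  have fin: "(\<integral>\<^sup>+ x. ennreal (g x) \<partial>\<nu>) \<noteq> \<infinity>" "(\<integral>\<^sup>+ x. ennreal (- g x) \<partial>\<nu>) \<noteq> \<infinity>"
    using assms by (auto simp: real_integrable_def)
  then obtain a b where ab: "(\<integral>\<^sup>+ x. ennreal (g x) \<partial>\<nu>) = ennreal a" "a \<ge> 0"
      "(\<integral>\<^sup>+ x. ennreal (- g x) \<partial>\<nu>) = ennreal b" "b \<ge> 0"
    by (metis ennreal_cases infinity_ennreal_def)
  then show ?thesis
    using real_lebesgue_integral_def[OF assms]
    by (auto simp: ext_integral_def ereal_minus_conv_def)
qed

lemma Lp_funs_iff:
  fixes \<mu> :: "'a::{real_normed_vector, second_countable_topology} measure"
  assumes "sets \<mu> = sets borel"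
  shows "y \<in> Lp_funs p \<mu> \<longleftrightarrow>
    y \<in> borel_measurable \<mu> \<and> integrable \<mu> (\<lambda>x. norm (y x) powr p)"
proof -
  have eq: "borel_measurable \<mu> = (borel_measurable borel :: ('a \<Rightarrow> 'a) set)"
    using assms by (intro measurable_cong_sets) auto
  have "integrable \<mu> (\<lambda>x. norm (y x) powr p) \<longleftrightarrow>
      (\<integral>\<^sup>+ x. ennreal (norm (y x) powr p) \<partial>\<mu>) < \<infinity>" if [measurable]: "y \<in> borel_measurable \<mu>"
    by (simp add: integrable_iff_bounded)
  then show ?thesis
    unfolding Lp_funs_def eq[symmetric] by blast
qed

lemma Lp_space_members: "Y \<in> Lp_space p \<mu> \<Longrightarrow> Y \<subseteq> Lp_funs p \<mu>"
  by (auto simp: Lp_space_def quotient_def Lp_rel_def)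

text \<open>Moves from classes to functions: classes are nonempty, and the estimate in
  \<open>Lp_dense\<close> holds for every representative.\<close>

lemma Lp_denseD:
  assumes "Lp_dense p \<mu> D" "y \<in> Lp_funs p \<mu>" "\<epsilon> > 0"
  obtains z where "z \<in> \<Union>D" "z \<in> Lp_funs p \<mu>" "Lp_norm p \<mu> (\<lambda>x. y x - z x) < \<epsilon>"
proof -
  let ?Y = "Lp_rel p \<mu> `` {y}"
  have y: "y \<in> ?Y" "?Y \<in> Lp_space p \<mu>"
    using assms by (auto simp: Lp_rel_def Lp_space_def quotient_def)
  then obtain Z where Z: "Z \<in> D" "\<forall>z\<in>Z. Lp_norm p \<mu> (\<lambda>x. y x - z x) < \<epsilon>"
    using assms unfolding Lp_dense_def by meson
  have "Z \<in> Lp_space p \<mu>"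
    using Z assms by (auto simp: Lp_dense_def)
  moreover from this obtain z where "z \<in> Z"
    by (auto simp: Lp_space_def quotient_def Lp_rel_def)
  ultimately show ?thesis
    using that Z Lp_space_members by blast
qed

section \<open>Greedy selection along a sequence\<close>

text \<open>A running maximiser of \<open>h x\<close> over the candidates \<open>x\<close>,
  \<open>d 0\<close>, ..., \<open>d (m - 1)\<close>. Starting at \<open>x\<close> corresponds to
  zero displacement.\<close>

primrec greedy :: "('a \<Rightarrow> 'a \<Rightarrow> real) \<Rightarrow> (nat \<Rightarrow> 'a) \<Rightarrow> nat \<Rightarrow> 'a \<Rightarrow> 'a" where
  "greedy h d 0 x = x"
| "greedy h d (Suc m) x = (if h x (greedy h d m x) < h x (d m) then d m else greedy h d m x)"

lemma greedy_mono: "m \<le> n \<Longrightarrow> h x (greedy h d m x) \<le> h x (greedy h d n x)"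
  by (rule lift_Suc_mono_le[of "\<lambda>m. h x (greedy h d m x)"]) auto

lemma greedy_ge: "h x (d m) \<le> h x (greedy h d (Suc m) x)"
  by auto

section \<open>The transport functional on L^p\<close>

locale transport_problem =
  fixes p M c :: real
    and \<mu> :: "'a::{real_normed_vector, second_countable_topology} measure"
    and f :: "'a \<Rightarrow> real"
  assumes p_ge_1: "p \<ge> 1"
    and \<mu>_p: "\<mu> \<in> borel_probs_p p"
    and cont: "continuous_on UNIV f"
    and c_nonneg: "c \<ge> 0"
    and growth: "\<And>x. \<bar>f x\<bar> \<le> M + c * norm x powr p"
begin

text \<open>Real-valued form of the integral in \<open>transport_sup\<close>; the two agree on
  \<open>Lp_funs p \<mu>\<close> by \<open>ext_integral_J\<close>.\<close>

definition J :: "('a \<Rightarrow> 'a) \<Rightarrow> real" where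
  "J y = (\<integral>x. f (x + y x) - norm (y x) powr p \<partial>\<mu>)"

lemma sets_\<mu> [simp, measurable_cong]: "sets \<mu> = sets borel"
  and prob_\<mu>: "prob_space \<mu>"
  using \<mu>_p by (auto simp: borel_probs_p_def borel_probs_def)

sublocale prob_space \<mu>
  by (rule prob_\<mu>)

lemma f_measurable [measurable]: "f \<in> borel_measurable borel"
  using cont by (rule borel_measurable_continuous_onI)

lemma integrable_norm_powr: "integrable \<mu> (\<lambda>x. norm x powr p)"
  using \<mu>_p by (auto simp: borel_probs_p_def integrable_iff_bounded)

lemma integrable_const_diff_powr: "integrable \<mu> (\<lambda>x. norm (z - x) powr p)"
  using p_ge_1 integrable_norm_powr by (intro integrable_norm_diff_powr) auto

lemma integrable_f: "integrable \<mu> f"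
  using integrable_comp_growth[OF finite_measure_axioms f_measurable _ growth, of "\<lambda>x. x"]
    integrable_norm_powr by simp

lemma
  assumes "y \<in> Lp_funs p \<mu>"
  shows Lp_measurable: "y \<in> borel_measurable borel"
    and integrable_powr_Lp: "integrable \<mu> (\<lambda>x. norm (y x) powr p)"
    and integrable_f_shift: "integrable \<mu> (\<lambda>x. f (x + y x))"
    and integrable_J: "integrable \<mu> (\<lambda>x. f (x + y x) - norm (y x) powr p)"
proof -
  show [measurable]: "y \<in> borel_measurable borel"
    and *: "integrable \<mu> (\<lambda>x. norm (y x) powr p)"
    using assms Lp_funs_iff[OF sets_\<mu>] by (auto simp: Lp_funs_def)
  show "integrable \<mu> (\<lambda>x. f (x + y x))"
    using p_ge_1 * integrable_norm_powr
    by (intro integrable_comp_growth[OF finite_measure_axioms f_measurable _ growth]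
        integrable_norm_add_powr) auto
  with * show "integrable \<mu> (\<lambda>x. f (x + y x) - norm (y x) powr p)"
    by auto
qed

lemma ext_integral_J:
  "y \<in> Lp_funs p \<mu> \<Longrightarrow> ext_integral \<mu> (\<lambda>x. f (x + y x) - norm (y x) powr p) = ereal (J y)"
  unfolding J_def by (intro ext_integral_eq_integral integrable_J)

section \<open>Lower bound for the risk measure by push-forwards\<close>

text \<open>The joint law of \<open>x\<close> and \<open>x + y x\<close> is a coupling whose cost is
  the p-th moment of \<open>y\<close>.\<close>

lemma wasserstein_shift_le:
  assumes y: "y \<in> Lp_funs p \<mu>"
  shows "wasserstein p \<mu> (distr \<mu> borel (\<lambda>x. x + y x)) \<le>
    ennreal ((\<integral>x. norm (y x) powr p \<partial>\<mu>) powr (1 / p))"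
proof -
  have [measurable]: "y \<in> borel_measurable borel"
    using y by (rule Lp_measurable)
  let ?\<pi> = "distr \<mu> borel (\<lambda>x. (x, x + y x))"
  \<comment> \<open>By second countability the Borel sigma-algebra of the product is the product
    sigma-algebra, so measurability can be checked coordinatewise.\<close>
  have m [measurable]: "(\<lambda>x. (x, x + y x)) \<in> borel_measurable \<mu>"
    by (simp add: borel_prod[symmetric])
  have fs: "(fst :: 'a \<times> 'a \<Rightarrow> 'a) \<in> borel_measurable borel"
    "(snd :: 'a \<times> 'a \<Rightarrow> 'a) \<in> borel_measurable borel"
    by (auto simp: borel_prod[symmetric])
  have "distr \<mu> borel (\<lambda>x. x) = \<mu>"
    using distr_id2[of borel \<mu>] by simp
  then have "?\<pi> \<in> couplings \<mu> (distr \<mu> borel (\<lambda>x. x + y x))"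
    using fs m by (auto simp: couplings_def borel_probs_def distr_distr comp_def
        intro!: prob_space_distr)
  then have "wasserstein p \<mu> (distr \<mu> borel (\<lambda>x. x + y x)) \<le>
      ennreal_powr (\<integral>\<^sup>+ z. ennreal (norm (snd z - fst z) powr p) \<partial>?\<pi>) (1 / p)"
    unfolding wasserstein_def by (rule INF_lower)
  also have "(\<integral>\<^sup>+ z. ennreal (norm (snd z - fst z) powr p) \<partial>?\<pi>) =
      (\<integral>\<^sup>+ x. ennreal (norm (y x) powr p) \<partial>\<mu>)"
    using fs m by (subst nn_integral_distr) auto
  also have "\<dots> = ennreal (\<integral>x. norm (y x) powr p \<partial>\<mu>)"
    using integrable_powr_Lp[OF y] by (intro nn_integral_eq_integral) auto
  finally show ?thesis
    by (simp add: ennreal_powr_def)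
qed

lemma J_le_risk_measure:
  assumes y: "y \<in> Lp_funs p \<mu>"
  shows "ereal (J y) \<le> risk_measure p \<mu> f"
proof -
  have [measurable]: "y \<in> borel_measurable borel"
    using y by (rule Lp_measurable)
  let ?\<nu> = "distr \<mu> borel (\<lambda>x. x + y x)"
  define C where "C = (\<integral>x. norm (y x) powr p \<partial>\<mu>)"
  have C: "C \<ge> 0"
    by (auto simp: C_def)
  have "wasserstein p \<mu> ?\<nu> \<le> ennreal (C powr (1 / p))"
    unfolding C_def by (rule wasserstein_shift_le[OF y])
  then obtain w where w: "wasserstein p \<mu> ?\<nu> = ennreal w" "0 \<le> w" "w \<le> C powr (1 / p)"
    by (cases "wasserstein p \<mu> ?\<nu>") (auto simp: top_unique)
  have "w powr p \<le> C"
    using powr_mono2[of p w "C powr (1 / p)"] w p_ge_1 C by (simp add: powr_powr)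
  have "ext_integral ?\<nu> f = ereal (\<integral>x. f (x + y x) \<partial>\<mu>)"
    using integrable_f_shift[OF y]
    by (subst ext_integral_eq_integral) (auto simp: integrable_distr_eq integral_distr)
  then have "ereal_minus_conv (ext_integral ?\<nu> f) (enn2ereal (ennreal_powr (wasserstein p \<mu> ?\<nu>) p)) =
      ereal ((\<integral>x. f (x + y x) \<partial>\<mu>) - w powr p)"
    using w by (simp add: ereal_minus_conv_def ennreal_powr_def)
  moreover have "J y = (\<integral>x. f (x + y x) \<partial>\<mu>) - C"
    unfolding J_def C_def using integrable_powr_Lp[OF y] integrable_f_shift[OF y] by simp
  ultimately have "ereal (J y) \<le>
      ereal_minus_conv (ext_integral ?\<nu> f) (enn2ereal (ennreal_powr (wasserstein p \<mu> ?\<nu>) p))"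
    using \<open>w powr p \<le> C\<close> by simp
  also have "\<dots> \<le> risk_measure p \<mu> f"
    unfolding risk_measure_def
    by (rule SUP_upper) (auto simp: borel_probs_def intro!: prob_space_distr)
  finally show ?thesis .
qed

section \<open>Pointwise maximisation over targets\<close>

definition h :: "'a \<Rightarrow> 'a \<Rightarrow> real" where
  "h x z = f z - norm (z - x) powr p"

lemma h_self [simp]: "h x x = f x"
  by (simp add: h_def)

lemma h_measurable [measurable]: "case_prod h \<in> borel_measurable (borel \<Otimes>\<^sub>M borel)"
  unfolding h_def by measurable

lemma greedy_measurable [measurable]: "greedy h d m \<in> borel_measurable borel"
proof (induction m)
  case (Suc m)
  have [measurable]: "greedy h d m \<in> borel_measurable borel"
    by fact
  show ?case
    unfolding greedy.simps by measurable
qed (simp add: greedy.simps(1)[abs_def])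

text \<open>At each step the displacement is either the old one or \<open>d m - x\<close>, so its
  p-th power is bounded by the sum of the two, and constant targets have integrable cost.\<close>

lemma greedy_Lp: "(\<lambda>x. greedy h d m x - x) \<in> Lp_funs p \<mu>"
proof -
  have "integrable \<mu> (\<lambda>x. norm (greedy h d m x - x) powr p)"
  proof (induction m)
    case (Suc m)
    show ?case
    proof (rule Bochner_Integration.integrable_bound)
      show "integrable \<mu> (\<lambda>x. norm (d m - x) powr p + norm (greedy h d m x - x) powr p)"
        using Suc integrable_const_diff_powr by auto
      show "(\<lambda>x. norm (greedy h d (Suc m) x - x) powr p) \<in> borel_measurable \<mu>"
        by measurable
    qed auto
  qed simp
  then show ?thesis
    by (auto simp: Lp_funs_iff[OF sets_\<mu>])
qed

lemma J_greedy: "J (\<lambda>x. greedy h d m x - x) = (\<integral>x. h x (greedy h d m x) \<partial>\<mu>)"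
  by (simp add: J_def h_def)

text \<open>If \<open>t\<close> lies strictly below the left-hand side, the points whose value
  exceeds \<open>t\<close> form an open set containing \<open>z\<close>, hence some
  \<open>d i\<close>, which is a candidate from stage \<open>Suc i\<close> on. Subtracting
  \<open>f x\<close>, the value at stage 0, makes the greedy values nonnegative, so
  \<open>ennreal\<close> does not truncate them.\<close>

lemma h_le_SUP_greedy:
  assumes dense: "\<And>U. open U \<Longrightarrow> U \<noteq> {} \<Longrightarrow> \<exists>i. d i \<in> U"
  shows "ennreal (h x z - f x) \<le> (SUP m. ennreal (h x (greedy h d m x) - f x))"
proof (rule dense_le)
  fix t assume t: "t < ennreal (h x z - f x)"
  let ?g = "\<lambda>z. ennreal (h x z - f x)"
  have "continuous_on UNIV ?g"
    unfolding h_def using cont p_ge_1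
    by (intro continuous_on_ennreal continuous_intros continuous_on_powr') auto
  then have "open (?g -` {t<..})"
    by (rule open_vimage[rotated]) auto
  then obtain i where "t < ?g (d i)"
    using dense[of "?g -` {t<..}"] t by blast
  also have "\<dots> \<le> ?g (greedy h d (Suc i) x)"
    by (intro ennreal_leI) (use greedy_ge[of h x d i] in linarith)
  also have "\<dots> \<le> (SUP m. ennreal (h x (greedy h d m x) - f x))"
    by (rule SUP_upper) auto
  finally show "t \<le> (SUP m. ennreal (h x (greedy h d m x) - f x))"
    by simp
qed

section \<open>Upper bound for the risk measure by couplings\<close>

text \<open>The pointwise bound by the greedy supremum depends only on the first coordinate, so
  integrating it over \<open>\<pi>\<close> leaves an integral over \<open>\<mu>\<close>, whatever
  the coupling.\<close>

lemma coupling_value_le: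
  assumes s: "\<And>y. y \<in> Lp_funs p \<mu> \<Longrightarrow> J y \<le> s"
    and \<pi>: "\<pi> \<in> couplings \<mu> \<nu>"
    and cost: "(\<integral>\<^sup>+ z. ennreal (norm (snd z - fst z) powr p) \<partial>\<pi>) = ennreal C" "C \<ge> 0"
  shows "integrable \<nu> f" "(\<integral>z. f z \<partial>\<nu>) - C \<le> s"
proof -
  have sets_\<pi> [simp, measurable_cong]: "sets \<pi> = sets (borel \<Otimes>\<^sub>M borel)"
    and prob_\<pi>: "prob_space \<pi>" and fst_\<pi>: "distr \<pi> borel fst = \<mu>" and snd_\<pi>: "distr \<pi> borel snd = \<nu>"
    using \<pi> unfolding borel_prod couplings_def borel_probs_def by auto
  interpret \<pi>: prob_space \<pi>
    by (rule prob_\<pi>)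
  have int_fst: "integrable \<pi> (\<lambda>z. norm (fst z) powr p)" "integrable \<pi> (\<lambda>z. f (fst z))"
    using integrable_norm_powr integrable_f unfolding fst_\<pi>[symmetric]
    by (auto simp: integrable_distr_eq)
  have int_cost: "integrable \<pi> (\<lambda>z. norm (snd z - fst z) powr p)"
    using cost by (auto simp: integrable_iff_bounded)
  \<comment> \<open>Splitting the second coordinate this way shows that finite cost transfers the
    finite p-th moment from \<open>\<mu>\<close> to \<open>\<nu>\<close>.\<close>
  have "integrable \<pi> (\<lambda>z. norm (fst z + (snd z - fst z)) powr p)"
    using p_ge_1 int_fst int_cost by (intro integrable_norm_add_powr) auto
  then have int_snd: "integrable \<pi> (\<lambda>z. f (snd z))"
    by (intro integrable_comp_growth[OF \<pi>.finite_measure_axioms f_measurable _ growth]) auto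
  then show "integrable \<nu> f"
    unfolding snd_\<pi>[symmetric] by (auto simp: integrable_distr_eq)
  obtain d :: "nat \<Rightarrow> 'a" where d: "\<And>U. open U \<Longrightarrow> U \<noteq> {} \<Longrightarrow> \<exists>i. d i \<in> U"
  proof -
    obtain D :: "'a set" where D: "countable D" "\<And>U. open U \<Longrightarrow> U \<noteq> {} \<Longrightarrow> \<exists>x\<in>D. x \<in> U"
      using countable_dense_exists by blast
    then have "D \<noteq> {}"
      by (metis UNIV_not_empty empty_iff open_UNIV)
    with D show ?thesis
      by (intro that[of "from_nat_into D"]) (metis from_nat_into_surj)
  qed
  let ?g = "\<lambda>m x. ennreal (h x (greedy h d m x) - f x)"
  have h_meas [measurable]: "(\<lambda>x. h x (greedy h d m x)) \<in> borel_measurable borel" for m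
    by measurable
  have h_int: "integrable \<mu> (\<lambda>x. h x (greedy h d m x))" for m
    using integrable_J[OF greedy_Lp[of d m]] by (simp add: h_def)
  have zero_Lp: "(\<lambda>x. 0) \<in> Lp_funs p \<mu>"
    using greedy_Lp[of d 0] by simp
  \<comment> \<open>The zero map is a competitor. Hence
    \<open>s - (\<integral>x. f x \<partial>\<mu>)\<close> is nonnegative, and bounds by its
    \<open>ennreal\<close> image can be read back as real bounds.\<close>
  have s_ge: "(\<integral>x. f x \<partial>\<mu>) \<le> s"
    using s[OF zero_Lp] p_ge_1 by (simp add: J_def)
  have "(\<integral>\<^sup>+ x. (SUP m. ?g m x) \<partial>\<mu>) = (SUP m. \<integral>\<^sup>+ x. ?g m x \<partial>\<mu>)"
    by (intro nn_integral_monotone_convergence_SUP)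
      (auto simp: mono_def le_fun_def intro!: ennreal_leI diff_right_mono greedy_mono)
  also have "\<dots> \<le> ennreal (s - (\<integral>x. f x \<partial>\<mu>))"
  proof (rule SUP_least)
    fix m
    have "(\<integral>\<^sup>+ x. ?g m x \<partial>\<mu>) = ennreal (\<integral>x. h x (greedy h d m x) - f x \<partial>\<mu>)"
      using h_int[of m] integrable_f greedy_mono[of 0 m h _ d]
      by (intro nn_integral_eq_integral) auto
    also have "(\<integral>x. h x (greedy h d m x) - f x \<partial>\<mu>) = J (\<lambda>x. greedy h d m x - x) - (\<integral>x. f x \<partial>\<mu>)"
      using h_int[of m] integrable_f by (simp add: J_greedy)
    finally show "(\<integral>\<^sup>+ x. ?g m x \<partial>\<mu>) \<le> ennreal (s - (\<integral>x. f x \<partial>\<mu>))"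
      using s[OF greedy_Lp[of d m]] by (simp add: ennreal_leI)
  qed
  finally have sup_le: "(\<integral>\<^sup>+ x. (SUP m. ?g m x) \<partial>\<mu>) \<le> ennreal (s - (\<integral>x. f x \<partial>\<mu>))" .
  have "(\<integral>\<^sup>+ z. ennreal (h (fst z) (snd z) - f (fst z)) \<partial>\<pi>) \<le> (\<integral>\<^sup>+ z. (SUP m. ?g m (fst z)) \<partial>\<pi>)"
    by (intro nn_integral_mono h_le_SUP_greedy d)
  also have "\<dots> = (\<integral>\<^sup>+ x. (SUP m. ?g m x) \<partial>distr \<pi> borel fst)"
    by (subst nn_integral_distr) auto
  also have "\<dots> \<le> ennreal (s - (\<integral>x. f x \<partial>\<mu>))"
    using sup_le by (simp add: fst_\<pi>)
  \<comment> \<open>This integrand may be negative; its integral is at most that of its positive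
    part, which was just bounded.\<close>
  finally have "(\<integral>z. h (fst z) (snd z) - f (fst z) \<partial>\<pi>) \<le> s - (\<integral>x. f x \<partial>\<mu>)"
    using s_ge by (intro integral_real_bounded) auto
  moreover have "(\<integral>z. h (fst z) (snd z) - f (fst z) \<partial>\<pi>) =
      (\<integral>z. f (snd z) \<partial>\<pi>) - (\<integral>z. norm (snd z - fst z) powr p \<partial>\<pi>) - (\<integral>z. f (fst z) \<partial>\<pi>)"
    unfolding h_def using int_fst int_snd int_cost by simp
  moreover have "(\<integral>z. norm (snd z - fst z) powr p \<partial>\<pi>) = C"
    using cost by (simp add: integral_eq_nn_integral)
  moreover have "(\<integral>z. f (fst z) \<partial>\<pi>) = (\<integral>x. f x \<partial>\<mu>)"
    unfolding fst_\<pi>[symmetric] by (subst integral_distr) auto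
  moreover have "(\<integral>z. f (snd z) \<partial>\<pi>) = (\<integral>x. f x \<partial>\<nu>)"
    unfolding snd_\<pi>[symmetric] by (subst integral_distr) auto
  ultimately show "(\<integral>z. f z \<partial>\<nu>) - C \<le> s"
    by simp
qed

text \<open>Near-optimal couplings suffice: each \<open>r\<close> above the distance
  \<open>w\<close> admits a coupling of cost at most \<open>r powr p\<close>, and then
  \<open>r\<close> decreases to \<open>w\<close>. No optimal coupling is required.\<close>

lemma risk_measure_le:
  assumes s: "\<And>y. y \<in> Lp_funs p \<mu> \<Longrightarrow> J y \<le> s"
  shows "risk_measure p \<mu> f \<le> ereal s"
  unfolding risk_measure_def
proof (rule SUP_least)
  fix \<nu> :: "'a measure" assume "\<nu> \<in> borel_probs"
  show "ereal_minus_conv (ext_integral \<nu> f) (enn2ereal (ennreal_powr (wasserstein p \<mu> \<nu>) p)) \<le> ereal s"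
  proof (cases "wasserstein p \<mu> \<nu>")
    case top
    \<comment> \<open>At infinite distance the convention gives \<open>-\<infinity>\<close>, even if
      the integral of \<open>f\<close> is \<open>\<infinity>\<close>.\<close>
    then show ?thesis
      by (cases "ext_integral \<nu> f") (auto simp: ereal_minus_conv_def ennreal_powr_def)
  next
    case (real w)
    have *: "integrable \<nu> f \<and> (\<integral>z. f z \<partial>\<nu>) - r powr p \<le> s" if "r > w" for r
    proof -
      have "wasserstein p \<mu> \<nu> < ennreal r"
        using real that by (simp add: ennreal_lessI)
      then obtain \<pi> where \<pi>: "\<pi> \<in> couplings \<mu> \<nu>"
        "ennreal_powr (\<integral>\<^sup>+ z. ennreal (norm (snd z - fst z) powr p) \<partial>\<pi>) (1 / p) < ennreal r"
        unfolding wasserstein_def by (auto simp: INF_less_iff)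
      then obtain C where C: "(\<integral>\<^sup>+ z. ennreal (norm (snd z - fst z) powr p) \<partial>\<pi>) = ennreal C" "C \<ge> 0"
        by (cases "\<integral>\<^sup>+ z. ennreal (norm (snd z - fst z) powr p) \<partial>\<pi>") (auto simp: ennreal_powr_def)
      then have "C powr (1 / p) \<le> r"
        using \<pi> by (simp add: ennreal_powr_def ennreal_less_iff)
      then have "C \<le> r powr p"
        using powr_mono2[of p "C powr (1 / p)" r] p_ge_1 C by (simp add: powr_powr)
      then show ?thesis
        using coupling_value_le[OF s \<pi>(1) C] by auto
    qed
    have int: "integrable \<nu> f"
      using *[of "w + 1"] by simp
    have "(\<integral>z. f z \<partial>\<nu>) - w powr p \<le> s"
    proof (rule tendsto_upperbound)
      \<comment> \<open>The base may tend to \<open>w = 0\<close>; the limit persists because the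
        exponent is positive and \<open>r\<close> is nonnegative near \<open>w\<close> from the
        right.\<close>
      show "((\<lambda>r. (\<integral>z. f z \<partial>\<nu>) - r powr p) \<longlongrightarrow> (\<integral>z. f z \<partial>\<nu>) - w powr p) (at_right w)"
        using p_ge_1 real
        by (intro tendsto_diff tendsto_const tendsto_powr' tendsto_ident_at)
          (auto simp: eventually_at_filter)
      show "\<forall>\<^sub>F r in at_right w. (\<integral>z. f z \<partial>\<nu>) - r powr p \<le> s"
        using * by (auto intro: eventually_mono[OF eventually_at_right_less])
    qed simp
    then show ?thesis
      using real by (simp add: ext_integral_eq_integral[OF int] ereal_minus_conv_def
          ennreal_powr_def)
  qed
qed

section \<open>Approximation of the functional along a dense set\<close>

text \<open>Choosing the approximations so fast that \<open>\<Sum>k. \<parallel>y - z k\<parallel>\<^sup>p\<close> is integrable gives both the almost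
  everywhere convergence and the majorant for dominated convergence.\<close>

lemma J_approx:
  assumes dense: "Lp_dense p \<mu> E" and y: "y \<in> Lp_funs p \<mu>"
  obtains z where "\<And>k. z k \<in> \<Union>E" "\<And>k. z k \<in> Lp_funs p \<mu>" "(\<lambda>k. J (z k)) \<longlonglongrightarrow> J y"
proof -
  \<comment> \<open>The radius is a p-th root so that the p-th power of the distance is at most
    \<open>(1/2) ^ k\<close>, a summable bound.\<close>
  have "\<exists>z. z \<in> \<Union>E \<and> z \<in> Lp_funs p \<mu> \<and> Lp_norm p \<mu> (\<lambda>x. y x - z x) < ((1/2) ^ k) powr (1 / p)"
    for k :: nat
    by (rule Lp_denseD[OF dense y, of "((1/2) ^ k) powr (1 / p)"]) auto
  then obtain z where z: "\<And>k. z k \<in> \<Union>E" "\<And>k. z k \<in> Lp_funs p \<mu>"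
    "\<And>k. Lp_norm p \<mu> (\<lambda>x. y x - z k x) < ((1/2) ^ k) powr (1 / p)"
    by metis
  have [measurable]: "y \<in> borel_measurable borel" "\<And>k. z k \<in> borel_measurable borel"
    using Lp_measurable y z by auto
  let ?e = "\<lambda>k x. norm (y x - z k x) powr p"
  define G where "G = (\<lambda>x. \<Sum>k. ?e k x)"
  have e_int: "integrable \<mu> (?e k)" for k
    using p_ge_1 y z by (intro integrable_norm_diff_powr integrable_powr_Lp) auto
  have e_le: "(\<integral>x. ?e k x \<partial>\<mu>) \<le> (1/2) ^ k" for k
  proof (rule ccontr)
    assume "\<not> ?thesis"
    then have "((1/2) ^ k) powr (1 / p) \<le> (\<integral>x. ?e k x \<partial>\<mu>) powr (1 / p)"
      using p_ge_1 by (intro powr_mono2) auto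
    with z(3)[of k] show False
      by (simp add: Lp_norm_def)
  qed
  \<comment> \<open>Summing in \<open>ennreal\<close> allows the exchange with the integral before
    pointwise summability is known; finiteness then yields it almost everywhere.\<close>
  have "(\<integral>\<^sup>+ x. (\<Sum>k. ennreal (?e k x)) \<partial>\<mu>) = (\<Sum>k. \<integral>\<^sup>+ x. ennreal (?e k x) \<partial>\<mu>)"
    by (intro nn_integral_suminf) auto
  also have "\<dots> = (\<Sum>k. ennreal (\<integral>x. ?e k x \<partial>\<mu>))"
    using e_int by (intro suminf_cong nn_integral_eq_integral) auto
  also have "\<dots> \<le> (\<Sum>k. ennreal ((1/2) ^ k))"
    using e_le by (intro suminf_le ennreal_leI) auto
  also have "\<dots> < \<infinity>"
    by (subst suminf_ennreal2) (auto simp: summable_geometric)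
  finally have sum_fin: "(\<integral>\<^sup>+ x. (\<Sum>k. ennreal (?e k x)) \<partial>\<mu>) < \<infinity>" .
  then have "AE x in \<mu>. (\<Sum>k. ennreal (?e k x)) \<noteq> \<infinity>"
    by (intro nn_integral_PInf_AE) auto
  then have summ: "AE x in \<mu>. summable (\<lambda>k. ?e k x)"
    by eventually_elim (auto intro: summable_suminf_not_top)
  have [measurable]: "G \<in> borel_measurable \<mu>"
    unfolding G_def by measurable
  have "(\<integral>\<^sup>+ x. ennreal (norm (G x)) \<partial>\<mu>) = (\<integral>\<^sup>+ x. (\<Sum>k. ennreal (?e k x)) \<partial>\<mu>)"
    using summ by (intro nn_integral_cong_AE, eventually_elim)
      (auto simp: G_def suminf_ennreal2 suminf_nonneg)
  with sum_fin have G_int: "integrable \<mu> G"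
    by (auto simp: integrable_iff_bounded)
  let ?b = "\<lambda>x. norm (y x) powr p + G x"
  define K where "K = (2::real) powr p"
  have K: "K \<ge> 0"
    by (simp add: K_def)
  \<comment> \<open>With \<open>K\<close> from \<open>norm_add_powr_le\<close>,
    \<open>K * ?b x\<close> dominates the p-th power of \<open>z k x\<close>; a second use of that
    lemma, inside the growth bound of \<open>f\<close>, handles \<open>x + z k x\<close>.\<close>
  let ?w = "\<lambda>x. M + c * (K * (norm x powr p + K * ?b x)) + K * ?b x"
  have "(\<lambda>k. J (z k)) \<longlonglongrightarrow> J y"
    unfolding J_def
  proof (rule integral_dominated_convergence[where w = ?w])
    show "integrable \<mu> ?w"
      using integrable_norm_powr integrable_powr_Lp[OF y] G_int by simp
    show "AE x in \<mu>. (\<lambda>k. f (x + z k x) - norm (z k x) powr p) \<longlonglongrightarrow> f (x + y x) - norm (y x) powr p"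
      using summ
    proof eventually_elim
      case (elim x)
      \<comment> \<open>Terms of a convergent series tend to 0; taking p-th roots turns this into
        norm convergence.\<close>
      have "(\<lambda>k. ?e k x powr (1 / p)) \<longlonglongrightarrow> 0 powr (1 / p)"
        using summable_LIMSEQ_zero[OF elim] p_ge_1
        by (intro tendsto_powr' tendsto_const) auto
      then have "(\<lambda>k. norm (y x - z k x)) \<longlonglongrightarrow> 0"
        using p_ge_1 by (simp add: powr_powr)
      then have "(\<lambda>k. z k x) \<longlonglongrightarrow> y x"
        by (subst tendsto_dist_iff) (simp add: dist_norm norm_minus_commute)
      then show ?case
        using p_ge_1
        by (intro tendsto_diff tendsto_norm_powr continuous_on_tendsto_compose[OF cont]
            tendsto_add tendsto_const) auto
    qed
    show "AE x in \<mu>. norm (f (x + z k x) - norm (z k x) powr p) \<le> ?w x" for k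
      using summ
    proof eventually_elim
      case (elim x)
      have "?e k x \<le> G x"
        unfolding G_def using sum_le_suminf[OF elim, of "{k}"] by auto
      moreover have "norm (z k x) powr p \<le> K * (norm (y x) powr p + ?e k x)"
        using norm_add_powr_le[of p "y x" "z k x - y x"] p_ge_1
        by (simp add: K_def norm_minus_commute)
      moreover have "K * (norm (y x) powr p + ?e k x) \<le> K * ?b x" if "?e k x \<le> G x"
        using K that by (intro mult_left_mono) auto
      ultimately have 1: "norm (z k x) powr p \<le> K * ?b x"
        by linarith
      have "norm (x + z k x) powr p \<le> K * (norm x powr p + norm (z k x) powr p)"
        using norm_add_powr_le[of p x "z k x"] p_ge_1 by (simp add: K_def)
      also have "\<dots> \<le> K * (norm x powr p + K * ?b x)"
        using 1 K by (intro mult_left_mono) auto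
      finally have "c * norm (x + z k x) powr p \<le> c * (K * (norm x powr p + K * ?b x))"
        using c_nonneg by (rule mult_left_mono)
      then show ?case
        using 1 growth[of "x + z k x"] powr_ge_zero[of "norm (z k x)" p]
        unfolding real_norm_def by linarith
    qed
  qed auto
  with z show ?thesis
    using that by blast
qed

text \<open>\<open>J_approx\<close> extends the bound from representatives in \<open>E\<close> to
  all of L^p, where \<open>risk_measure_le\<close> applies; the converse is
  \<open>J_le_risk_measure\<close>.\<close>

lemma transport_sup_dense:
  assumes dense: "Lp_dense p \<mu> E"
  shows "transport_sup p \<mu> f E = risk_measure p \<mu> f"
proof -
  have sub: "\<Union>E \<subseteq> Lp_funs p \<mu>"
    using dense Lp_space_members by (fastforce simp: Lp_dense_def)
  then have eq: "transport_sup p \<mu> f E = (SUP y\<in>\<Union>E. ereal (J y))"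
    unfolding transport_sup_def by (intro SUP_cong refl ext_integral_J) auto
  have J_le: "ereal (J y) \<le> transport_sup p \<mu> f E" if "y \<in> Lp_funs p \<mu>" for y
  proof -
    obtain z where z: "\<And>k. z k \<in> \<Union>E" "(\<lambda>k. J (z k)) \<longlonglongrightarrow> J y"
      using J_approx[OF dense \<open>y \<in> Lp_funs p \<mu>\<close>] by metis
    show ?thesis
    proof (rule tendsto_upperbound)
      show "(\<lambda>k. ereal (J (z k))) \<longlonglongrightarrow> ereal (J y)"
        using z by simp
      show "\<forall>\<^sub>F k in sequentially. ereal (J (z k)) \<le> transport_sup p \<mu> f E"
        unfolding eq using z by (intro always_eventually allI SUP_upper)
    qed simp
  qed
  \<comment> \<open>The zero map excludes the value \<open>-\<infinity>\<close>. The value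
    \<open>\<infinity>\<close> is trivial, and \<open>risk_measure_le\<close> covers a real
    value.\<close>
  have "(\<lambda>x. 0) \<in> Lp_funs p \<mu>"
    using p_ge_1 by (simp add: Lp_funs_def)
  from J_le[OF this] have "transport_sup p \<mu> f E \<noteq> -\<infinity>"
    by auto
  then have "risk_measure p \<mu> f \<le> transport_sup p \<mu> f E"
    using J_le risk_measure_le by (cases "transport_sup p \<mu> f E") auto
  moreover have "transport_sup p \<mu> f E \<le> risk_measure p \<mu> f"
    unfolding eq using sub by (intro SUP_least J_le_risk_measure) auto
  ultimately show ?thesis
    by simp
qed

end

section \<open>Increasing families and the limit\<close>

lemma transport_sup_mono: "E \<subseteq> F \<Longrightarrow> transport_sup p \<mu> f E \<le> transport_sup p \<mu> f F"
  unfolding transport_sup_def by (intro SUP_subset_mono) auto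

text \<open>Identifies the limit of the increasing sequence, its supremum, with the value at the
  dense union.\<close>

lemma transport_sup_UN: "transport_sup p \<mu> f (\<Union>n. D n) = (SUP n. transport_sup p \<mu> f (D n))"
  proof -
  have "\<Union>(\<Union>n. D n) = (\<Union>n. \<Union>(D n))"
    by blast
  then show ?thesis
    unfolding transport_sup_def by (simp only: SUP_UNION)
qed

theorem proposition5p1:
  fixes p M c :: real
    and \<mu> :: "'a::{banach, second_countable_topology} measure"
    and f :: "'a \<Rightarrow> real"
    and D :: "nat \<Rightarrow> ('a \<Rightarrow> 'a) set set"
  assumes "p \<ge> 1"
    and "\<mu> \<in> borel_probs_p p"
    and "continuous_on UNIV f"
    and "M \<ge> 0" and "0 \<le> c" and "c < 1"
    and "\<And>x. \<bar>f x\<bar> \<le> M + c * norm x powr p"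
    and "\<And>n. D n \<subseteq> Lp_space p \<mu>"
    and "\<And>n. D n \<subseteq> D (Suc n)"
    and "Lp_dense p \<mu> (\<Union>n. D n)"
  shows "incseq (\<lambda>n. transport_sup p \<mu> f (D n)) \<and>
         (\<lambda>n. transport_sup p \<mu> f (D n)) \<longlonglongrightarrow> risk_measure p \<mu> f"
proof
  interpret transport_problem p M c \<mu> f
    by unfold_locales (use assms in auto)
  show inc: "incseq (\<lambda>n. transport_sup p \<mu> f (D n))"
    using assms(9) by (intro incseq_SucI transport_sup_mono)
  show "(\<lambda>n. transport_sup p \<mu> f (D n)) \<longlonglongrightarrow> risk_measure p \<mu> f"
    using LIMSEQ_SUP[OF inc] transport_sup_dense[OF assms(10)] by (simp add: transport_sup_UN)
qed

end
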